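(* Let $G$ be an 8-dimensional Riemannian Lie group containing $K=\mathbf{SU}(2)\times\mathbf{SU}(2)$ as a Lie subgroup, where $K$ carries the standard Riemannian metric induced by its Killing form, whose Lie algebra $\mathfrak g$ has the orthonormal basis $\{A,B,C,R,S,T,X,Y\}$ and the Lie bracket relations written out in the context, with arbitrary real coefficients $\rho,b_{11},b_{21},c_{11},c_{12},c_{21},c_{22},s_{14},s_{24},t_{14},t_{15},t_{24},t_{25}$. Let $(\lambda_j,\mu_j,\nu_j)\in\mathbb R^3$ with $\lambda_j^2+\mu_j^2+\nu_j^2=1$ for $j=1,2$, and let $J$ be the left-invariant almost Hermitian structure on $G$ given by the matrix in the context. Then $(G,g,J)$ never belongs to the class $\mathcal W_4$, i.e. it is never locally conformal Kähler; in particular it is never Kähler.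
   Context: The Lie algebra $\mathfrak g$ of $G$ is identified with the left-invariant vector fields; the left-invariant metric $g$ on $G$ is the one for which $\{A,B,C,R,S,T,X,Y\}$ is orthonormal. The subalgebra $\mathfrak{su}(2)\oplus\mathfrak{su}(2)$ of $K$ is spanned by $A,B,C,R,S,T$, with $[A,B]=2C$, $[B,C]=2A$, $[C,A]=2B$, $[R,S]=2T$, $[S,T]=2R$, $[T,R]=2S$, and each of $A,B,C$ commutes with each of $R,S,T$. The remaining brackets are $$[A,X]=-b_{11}B-c_{11}C,\quad [A,Y]=-b_{21}B-c_{21}C,$$ $$[B,X]=b_{11}A-c_{12}C,\quad [B,Y]=b_{21}A-c_{22}C,$$ $$[C,X]=c_{11}A+c_{12}B,\quad [C,Y]=c_{21}A+c_{22}B,$$ $$[R,X]=-s_{14}S-t_{14}T,\quad [R,Y]=-s_{24}S-t_{24}T,$$ $$[S,X]=s_{14}R-t_{15}T,\quad [S,Y]=s_{24}R-t_{25}T,$$ $$[T,X]=t_{14}R+t_{15}S,\quad [T,Y]=t_{24}R+t_{25}S,$$ $$[X,Y]=\rho X+\theta_1A+\theta_2B+\theta_3C+\theta_4R+\theta_5S+\theta_6T,$$ where $$2\theta_1=-\rho c_{12}+b_{11}c_{21}-b_{21}c_{11},\quad 2\theta_2=\rho c_{11}+b_{11}c_{22}-b_{21}c_{12},\quad 2\theta_3=-\rho b_{11}+c_{11}c_{22}-c_{12}c_{21},$$ $$2\theta_4=-\rho t_{15}+s_{14}t_{24}-s_{24}t_{14},\quad 2\theta_5=\rho t_{14}+s_{14}t_{25}-s_{24}t_{15},\quad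 2\theta_6=-\rho s_{14}+t_{14}t_{25}-t_{15}t_{24}.$$ The 13 coefficients may be arbitrary real numbers (the Jacobi identity then holds). In the ordered basis $(A,B,C,R,S,T,X,Y)$, acting on column vectors of coordinates, $J$ is the matrix $$\begin{pmatrix} 0&\nu_1&\mu_1&\lambda_1\lambda_2&-\lambda_1\mu_2&\lambda_1\nu_2&0&0\\ -\nu_1&0&\lambda_1&-\mu_1\lambda_2&\mu_1\mu_2&-\mu_1\nu_2&0&0\\ -\mu_1&-\lambda_1&0&\nu_1\lambda_2&-\nu_1\mu_2&\nu_1\nu_2&0&0\\ -\lambda_1\lambda_2&\mu_1\lambda_2&-\nu_1\lambda_2&0&\nu_2&\mu_2&0&0\\ \lambda_1\mu_2&-\mu_1\mu_2&\nu_1\mu_2&-\nu_2&0&\lambda_2&0&0\\ -\lambda_1\nu_2&\mu_1\nu_2&-\nu_1\nu_2&-\mu_2&-\lambda_2&0&0&0\\ 0&0&0&0&0&0&0&-1\\ 0&0&0&0&0&0&1&0 \end{pmatrix},$$ extended to $G$ by left translation; it satisfies $J^2=-\mathrm{id}$ and $g(JE,JF)=g(E,F)$. Let $\nabla$ be the Levi-Civita connection, $\omega(E,F)=g(JE,F)$ the Kähler form, and $\alpha(E,F,Z)=(\nabla_E\omega)(F,Z)=E(\omega(F,Z))-\omega(\nabla_EF,Z)-\omega(F,\nabla_EZ)$. For an orthonormal frame $e_1,\dots,e_8$ put $\tilde\alpha(Z)=-\sum_{j=1}^{8}\alpha(e_j,e_j,Z)$. With $2n=8$, the manifold $(G,g,J)$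 belongs to the class $\mathcal W_4$ (is called locally conformal Kähler) if for all $E,F,Z$ $$\alpha(E,F,Z)=-\frac{1}{2(n-1)}\Big(g(E,F)\tilde\alpha(Z)-g(E,Z)\tilde\alpha(F)-g(E,JF)\tilde\alpha(JZ)+g(E,JZ)\tilde\alpha(JF)\Big).$$ It is Kähler if $J$ is integrable and $d\omega=0$, equivalently $\nabla\omega=0$. *)

theory Defs
  imports "HOL-Analysis.Analysis" "HOL-Library.Function_Algebras"
begin

section \<open>Smooth manifolds and Lie groups\<close>

text \<open>All partial derivatives up to order \<open>k\<close> exist and are continuous; only meaningful
  for open sets and a finite-dimensional domain.\<close>

primrec Ck_on :: "nat \<Rightarrow> 'a::real_normed_vector set \<Rightarrow> ('a \<Rightarrow> 'b::real_normed_vector) \<Rightarrow> bool" where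
  "Ck_on 0 S f \<longleftrightarrow> continuous_on S f"
| "Ck_on (Suc k) S f \<longleftrightarrow>
     (\<forall>x\<in>S. f differentiable (at x)) \<and> (\<forall>v. Ck_on k S (\<lambda>x. frechet_derivative f (at x) v))"

definition smooth_on :: "'a::real_normed_vector set \<Rightarrow> ('a \<Rightarrow> 'b::real_normed_vector) \<Rightarrow> bool" where
  "smooth_on S f \<longleftrightarrow> open S \<and> (\<forall>k. Ck_on k S f)"

text \<open>The underlying set of a manifold is a whole type \<open>'m\<close>; Hausdorffness and second
  countability come from the type classes. A chart is a pair (domain, coordinate map).\<close>

type_synonym ('m, 'e) atlas = "('m set \<times> ('m \<Rightarrow> 'e)) set"

definition smooth_atlas ::
    "('m::{t2_space,second_countable_topology}, 'e::euclidean_space) atlas \<Rightarrow> bool" where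
  "smooth_atlas \<A> \<longleftrightarrow>
     (\<Union>(U, \<phi>)\<in>\<A>. U) = UNIV \<and>
     (\<forall>(U, \<phi>)\<in>\<A>. open U \<and> open (\<phi> ` U) \<and> homeomorphism U (\<phi> ` U) \<phi> (inv_into U \<phi>)) \<and>
     (\<forall>(U, \<phi>)\<in>\<A>. \<forall>(V, \<psi>)\<in>\<A>. smooth_on (\<phi> ` (U \<inter> V)) (\<psi> \<circ> inv_into U \<phi>))"

definition prod_atlas :: "('m, 'e) atlas \<Rightarrow> ('n, 'f) atlas \<Rightarrow> ('m \<times> 'n, 'e \<times> 'f) atlas" where
  "prod_atlas \<A> \<B> = {(U \<times> V, map_prod \<phi> \<psi>) | U V \<phi> \<psi>. (U, \<phi>) \<in> \<A> \<and> (V, \<psi>) \<in> \<B>}"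

definition smooth_map ::
    "('m::topological_space, 'e::euclidean_space) atlas \<Rightarrow>
     ('n::topological_space, 'f::euclidean_space) atlas \<Rightarrow> ('m \<Rightarrow> 'n) \<Rightarrow> bool" where
  "smooth_map \<A> \<B> h \<longleftrightarrow> continuous_on UNIV h \<and>
     (\<forall>(U, \<phi>)\<in>\<A>. \<forall>(V, \<psi>)\<in>\<B>. smooth_on (\<phi> ` (U \<inter> h -` V)) (\<psi> \<circ> h \<circ> inv_into U \<phi>))"

definition C_infty :: "('m, 'e::euclidean_space) atlas \<Rightarrow> ('m \<Rightarrow> real) set" where
  "C_infty \<A> = {f. \<forall>(U, \<phi>)\<in>\<A>. smooth_on (\<phi> ` U) (f \<circ> inv_into U \<phi>)}"

definition lie_group ::
    "('g::{t2_space,second_countable_topology}, 'e::euclidean_space) atlas \<Rightarrow>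
     ('g \<Rightarrow> 'g \<Rightarrow> 'g) \<Rightarrow> 'g \<Rightarrow> ('g \<Rightarrow> 'g) \<Rightarrow> bool" where
  "lie_group \<A> gmul gid ginv \<longleftrightarrow>
     smooth_atlas \<A> \<and> group gmul gid ginv \<and>
     smooth_map (prod_atlas \<A> \<A>) \<A> (\<lambda>(x, y). gmul x y) \<and> smooth_map \<A> \<A> ginv"


section \<open>Vector fields\<close>

text \<open>Smooth vector fields are the derivations of the algebra of smooth functions. They are
  set to 0 on non-smooth functions, so that equality of vector fields is equality of HOL functions.\<close>

type_synonym 'm vf = "('m \<Rightarrow> real) \<Rightarrow> 'm \<Rightarrow> real"

definition vector_fields :: "('m, 'e::euclidean_space) atlas \<Rightarrow> 'm vf set" where
  "vector_fields \<A> = {D.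
     (\<forall>f\<in>C_infty \<A>. D f \<in> C_infty \<A>) \<and>
     (\<forall>f\<in>C_infty \<A>. \<forall>h\<in>C_infty \<A>. D (f + h) = D f + D h) \<and>
     (\<forall>c. \<forall>f\<in>C_infty \<A>. D ((\<lambda>_. c) * f) = (\<lambda>_. c) * D f) \<and>
     (\<forall>f\<in>C_infty \<A>. \<forall>h\<in>C_infty \<A>. D (f * h) = D f * h + f * D h) \<and>
     (\<forall>f. f \<notin> C_infty \<A> \<longrightarrow> D f = 0)}"

definition smul :: "('m \<Rightarrow> real) \<Rightarrow> 'm vf \<Rightarrow> 'm vf"  (infixr \<open>\<odot>\<close> 75) where
  "u \<odot> D = (\<lambda>f. u * D f)"

abbreviation cmul :: "real \<Rightarrow> 'm vf \<Rightarrow> 'm vf"  (infixr \<open>\<cdot>\<close> 75) where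
  "c \<cdot> D \<equiv> (\<lambda>_. c) \<odot> D"

definition lin_comb :: "real list \<Rightarrow> 'm vf list \<Rightarrow> 'm vf" where
  "lin_comb cs e = (\<Sum>i<length e. cs ! i \<cdot> e ! i)"

definition lie_bracket :: "'m vf \<Rightarrow> 'm vf \<Rightarrow> 'm vf" where
  "lie_bracket D E = (\<lambda>f. D (E f) - E (D f))"

definition pushforward :: "('m \<Rightarrow> 'm) \<Rightarrow> 'm vf \<Rightarrow> 'm vf" where
  "pushforward \<phi> D = (\<lambda>f. D (f \<circ> \<phi>) \<circ> inv \<phi>)"

definition left_invariant_fields ::
    "('g, 'e::euclidean_space) atlas \<Rightarrow> ('g \<Rightarrow> 'g \<Rightarrow> 'g) \<Rightarrow> 'g vf set" where
  "left_invariant_fields \<A> gmul = {D \<in> vector_fields \<A>. \<forall>a. pushforward (gmul a) D = D}"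

definition lie_algebra_basis ::
    "('g, 'e::euclidean_space) atlas \<Rightarrow> ('g \<Rightarrow> 'g \<Rightarrow> 'g) \<Rightarrow> 'g vf list \<Rightarrow> bool" where
  "lie_algebra_basis \<A> gmul e \<longleftrightarrow>
     set e \<subseteq> left_invariant_fields \<A> gmul \<and>
     (\<forall>D\<in>left_invariant_fields \<A> gmul. \<exists>!cs. length cs = length e \<and> D = lin_comb cs e)"


section \<open>Riemannian metrics and the Levi-Civita connection\<close>

type_synonym 'm metric = "'m vf \<Rightarrow> 'm vf \<Rightarrow> 'm \<Rightarrow> real"

text \<open>Tensor fields are represented by their \<open>C\<^sup>\<infinity>\<close>-multilinear action on vector fields;
  a vector field \<open>D\<close> vanishes at \<open>p\<close> iff \<open>D f p = 0\<close> for all smooth \<open>f\<close>.\<close>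

definition riemannian_metric :: "('m, 'e::euclidean_space) atlas \<Rightarrow> 'm metric \<Rightarrow> bool" where
  "riemannian_metric \<A> g \<longleftrightarrow>
     (\<forall>D\<in>vector_fields \<A>. \<forall>E\<in>vector_fields \<A>. g D E \<in> C_infty \<A> \<and> g D E = g E D) \<and>
     (\<forall>D\<in>vector_fields \<A>. \<forall>E\<in>vector_fields \<A>. \<forall>F\<in>vector_fields \<A>. g (D + E) F = g D F + g E F) \<and>
     (\<forall>u\<in>C_infty \<A>. \<forall>D\<in>vector_fields \<A>. \<forall>E\<in>vector_fields \<A>. g (u \<odot> D) E = u * g D E) \<and>
     (\<forall>D\<in>vector_fields \<A>. \<forall>p. 0 \<le> g D D p \<and> (g D D p = 0 \<longrightarrow> (\<forall>f\<in>C_infty \<A>. D f p = 0)))"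

definition left_invariant_metric ::
    "('g, 'e::euclidean_space) atlas \<Rightarrow> ('g \<Rightarrow> 'g \<Rightarrow> 'g) \<Rightarrow> 'g metric \<Rightarrow> bool" where
  "left_invariant_metric \<A> gmul g \<longleftrightarrow>
     (\<forall>a. \<forall>D\<in>vector_fields \<A>. \<forall>E\<in>vector_fields \<A>.
        g (pushforward (gmul a) D) (pushforward (gmul a) E) = g D E \<circ> inv (gmul a))"

definition orthonormal :: "'m metric \<Rightarrow> 'm vf list \<Rightarrow> bool" where
  "orthonormal g e \<longleftrightarrow>
     (\<forall>i<length e. \<forall>j<length e. g (e ! i) (e ! j) = (\<lambda>_. if i = j then 1 else 0))"

definition orthonormal_frame_at ::
    "('m, 'e::euclidean_space) atlas \<Rightarrow> 'm metric \<Rightarrow> 'm \<Rightarrow> 'm vf list \<Rightarrow> bool" where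
  "orthonormal_frame_at \<A> g p e \<longleftrightarrow>
     length e = DIM('e) \<and> set e \<subseteq> vector_fields \<A> \<and>
     (\<forall>i<length e. \<forall>j<length e. g (e ! i) (e ! j) p = (if i = j then 1 else 0))"

definition levi_civita ::
    "('m, 'e::euclidean_space) atlas \<Rightarrow> 'm metric \<Rightarrow> ('m vf \<Rightarrow> 'm vf \<Rightarrow> 'm vf) \<Rightarrow> bool" where
  "levi_civita \<A> g nab \<longleftrightarrow>
     (\<forall>D\<in>vector_fields \<A>. \<forall>E\<in>vector_fields \<A>. nab D E \<in> vector_fields \<A>) \<and>
     (\<forall>D\<in>vector_fields \<A>. \<forall>E\<in>vector_fields \<A>. \<forall>F\<in>vector_fields \<A>.
        nab (D + E) F = nab D F + nab E F \<and> nab D (E + F) = nab D E + nab D F) \<and>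
     (\<forall>u\<in>C_infty \<A>. \<forall>D\<in>vector_fields \<A>. \<forall>E\<in>vector_fields \<A>.
        nab (u \<odot> D) E = u \<odot> nab D E \<and> nab D (u \<odot> E) = D u \<odot> E + u \<odot> nab D E) \<and>
     (\<forall>D\<in>vector_fields \<A>. \<forall>E\<in>vector_fields \<A>. nab D E - nab E D = lie_bracket D E) \<and>
     (\<forall>D\<in>vector_fields \<A>. \<forall>E\<in>vector_fields \<A>. \<forall>F\<in>vector_fields \<A>.
        D (g E F) = g (nab D E) F + g E (nab D F))"


section \<open>Almost Hermitian structures\<close>

definition almost_hermitian ::
    "('m, 'e::euclidean_space) atlas \<Rightarrow> 'm metric \<Rightarrow> ('m vf \<Rightarrow> 'm vf) \<Rightarrow> bool" where
  "almost_hermitian \<A> g J \<longleftrightarrow>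
     (\<forall>D\<in>vector_fields \<A>. J D \<in> vector_fields \<A> \<and> J (J D) = - D) \<and>
     (\<forall>D\<in>vector_fields \<A>. \<forall>E\<in>vector_fields \<A>. J (D + E) = J D + J E \<and> g (J D) (J E) = g D E) \<and>
     (\<forall>u\<in>C_infty \<A>. \<forall>D\<in>vector_fields \<A>. J (u \<odot> D) = u \<odot> J D)"

definition left_invariant_endo ::
    "('g, 'e::euclidean_space) atlas \<Rightarrow> ('g \<Rightarrow> 'g \<Rightarrow> 'g) \<Rightarrow> ('g vf \<Rightarrow> 'g vf) \<Rightarrow> bool" where
  "left_invariant_endo \<A> gmul J \<longleftrightarrow>
     (\<forall>a. \<forall>D\<in>vector_fields \<A>. J (pushforward (gmul a) D) = pushforward (gmul a) (J D))"

definition kaehler_form :: "'m metric \<Rightarrow> ('m vf \<Rightarrow> 'm vf) \<Rightarrow> 'm vf \<Rightarrow> 'm vf \<Rightarrow> 'm \<Rightarrow> real" where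
  "kaehler_form g J E F = g (J E) F"

definition nabla_omega ::
    "'m metric \<Rightarrow> ('m vf \<Rightarrow> 'm vf) \<Rightarrow> ('m vf \<Rightarrow> 'm vf \<Rightarrow> 'm vf) \<Rightarrow>
     'm vf \<Rightarrow> 'm vf \<Rightarrow> 'm vf \<Rightarrow> 'm \<Rightarrow> real" where
  "nabla_omega g J nab E F Z =
     E (kaehler_form g J F Z) - kaehler_form g J (nab E F) Z - kaehler_form g J F (nab E Z)"

definition nabla_omega_trace ::
    "'m metric \<Rightarrow> ('m vf \<Rightarrow> 'm vf) \<Rightarrow> ('m vf \<Rightarrow> 'm vf \<Rightarrow> 'm vf) \<Rightarrow>
     'm vf list \<Rightarrow> 'm vf \<Rightarrow> 'm \<Rightarrow> real" where
  "nabla_omega_trace g J nab e Z = - (\<Sum>j<length e. nabla_omega g J nab (e ! j) (e ! j) Z)"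

text \<open>The real dimension is \<open>2n\<close>. The condition is imposed pointwise, since on a general manifold
  vector fields forming an orthonormal basis exist only at (or near) a given point; the trace
  does not depend on the frame.\<close>

definition class_W4 ::
    "('m, 'e::euclidean_space) atlas \<Rightarrow> 'm metric \<Rightarrow> ('m vf \<Rightarrow> 'm vf) \<Rightarrow>
     ('m vf \<Rightarrow> 'm vf \<Rightarrow> 'm vf) \<Rightarrow> bool" where
  "class_W4 \<A> g J nab \<longleftrightarrow>
     (\<forall>p e. orthonormal_frame_at \<A> g p e \<longrightarrow>
       (\<forall>E\<in>vector_fields \<A>. \<forall>F\<in>vector_fields \<A>. \<forall>Z\<in>vector_fields \<A>.
         let n = real DIM('e) / 2; \<tau> = nabla_omega_trace g J nab e in
         nabla_omega g J nab E F Z p =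
           - (1 / (2 * (n - 1))) *
             (g E F p * \<tau> Z p - g E Z p * \<tau> F p
              - g E (J F) p * \<tau> (J Z) p + g E (J Z) p * \<tau> (J F) p)))"

definition nijenhuis :: "('m vf \<Rightarrow> 'm vf) \<Rightarrow> 'm vf \<Rightarrow> 'm vf \<Rightarrow> 'm vf" where
  "nijenhuis J D E =
     lie_bracket (J D) (J E) - J (lie_bracket (J D) E) - J (lie_bracket D (J E)) - lie_bracket D E"

text \<open>By Newlander-Nirenberg, vanishing of this tensor is integrability of an almost complex
  structure.\<close>

definition integrable_J :: "('m, 'e::euclidean_space) atlas \<Rightarrow> ('m vf \<Rightarrow> 'm vf) \<Rightarrow> bool" where
  "integrable_J \<A> J \<longleftrightarrow> (\<forall>D\<in>vector_fields \<A>. \<forall>E\<in>vector_fields \<A>. nijenhuis J D E = 0)"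

definition ext_deriv2 :: "('m vf \<Rightarrow> 'm vf \<Rightarrow> 'm \<Rightarrow> real) \<Rightarrow> 'm vf \<Rightarrow> 'm vf \<Rightarrow> 'm vf \<Rightarrow> 'm \<Rightarrow> real" where
  "ext_deriv2 \<omega> D E F =
     D (\<omega> E F) - E (\<omega> D F) + F (\<omega> D E)
     - \<omega> (lie_bracket D E) F + \<omega> (lie_bracket D F) E - \<omega> (lie_bracket E F) D"

definition kaehler ::
    "('m, 'e::euclidean_space) atlas \<Rightarrow> 'm metric \<Rightarrow> ('m vf \<Rightarrow> 'm vf) \<Rightarrow> bool" where
  "kaehler \<A> g J \<longleftrightarrow> integrable_J \<A> J \<and>
     (\<forall>D\<in>vector_fields \<A>. \<forall>E\<in>vector_fields \<A>. \<forall>F\<in>vector_fields \<A>.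
        ext_deriv2 (kaehler_form g J) D E F = 0)"


section \<open>The subgroup \<open>SU(2) \<times> SU(2)\<close>\<close>

definition SU2 :: "(complex^2^2) set" where
  "SU2 = {M. M ** (\<chi> i j. cnj (M $ j $ i)) = mat 1 \<and> det M = 1}"

abbreviation SU2xSU2 :: "((complex^2^2) \<times> (complex^2^2)) set" where
  "SU2xSU2 \<equiv> SU2 \<times> SU2"

text \<open>Smoothness of a function on an embedded submanifold \<open>K\<close> of a Euclidean space.\<close>

definition smooth_on_submanifold ::
    "'a::real_normed_vector set \<Rightarrow> ('a \<Rightarrow> real) \<Rightarrow> bool" where
  "smooth_on_submanifold K h \<longleftrightarrow>
     (\<forall>x\<in>K. \<exists>U F. open U \<and> x \<in> U \<and> smooth_on U F \<and> (\<forall>y\<in>K \<inter> U. F y = h y))"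

definition velocity :: "('m, 'e::euclidean_space) atlas \<Rightarrow> (real \<Rightarrow> 'm) \<Rightarrow> ('m \<Rightarrow> real) \<Rightarrow> real" where
  "velocity \<A> c = (\<lambda>f. if f \<in> C_infty \<A> then deriv (\<lambda>t. f (c t)) 0 else 0)"

text \<open>\<open>\<iota>\<close> embeds \<open>SU(2) \<times> SU(2)\<close> as a Lie subgroup with Lie algebra spanned by \<open>k\<close>: it is an
  injective homomorphism, smooth (tested against smooth functions), and the tangent
  space of its image at the identity consists of the values there of the span of \<open>k\<close>.\<close>

definition SU2xSU2_subgroup ::
    "('g, 'e::euclidean_space) atlas \<Rightarrow> ('g \<Rightarrow> 'g \<Rightarrow> 'g) \<Rightarrow> 'g \<Rightarrow>
     ((complex^2^2) \<times> (complex^2^2) \<Rightarrow> 'g) \<Rightarrow> 'g vf list \<Rightarrow> bool" where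
  "SU2xSU2_subgroup \<A> gmul gid \<iota> k \<longleftrightarrow>
     inj_on \<iota> SU2xSU2 \<and>
     (\<forall>(M, N)\<in>SU2xSU2. \<forall>(M', N')\<in>SU2xSU2. \<iota> (M ** M', N ** N') = gmul (\<iota> (M, N)) (\<iota> (M', N'))) \<and>
     (\<forall>f\<in>C_infty \<A>. smooth_on_submanifold SU2xSU2 (f \<circ> \<iota>)) \<and>
     {velocity \<A> (\<iota> \<circ> \<gamma>) | \<gamma>. smooth_on UNIV \<gamma> \<and> range \<gamma> \<subseteq> SU2xSU2 \<and> \<gamma> 0 = (mat 1, mat 1)} =
     {(\<lambda>f. lin_comb cs k f gid) | cs. length cs = length k}"

text \<open>The trace defining the Killing form of the span of \<open>k\<close> is computed in the \<open>g\<close>-orthonormal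
  basis \<open>k\<close>; as the form is negative definite, the metric it induces is a negative multiple.\<close>

definition killing_form :: "'g metric \<Rightarrow> 'g vf list \<Rightarrow> 'g vf \<Rightarrow> 'g vf \<Rightarrow> 'g \<Rightarrow> real" where
  "killing_form g k U V = (\<Sum>i<length k. g (lie_bracket U (lie_bracket V (k ! i))) (k ! i))"

definition killing_metric :: "'g metric \<Rightarrow> 'g vf list \<Rightarrow> bool" where
  "killing_metric g k \<longleftrightarrow>
     (\<exists>c>0. \<forall>U\<in>set k. \<forall>V\<in>set k. g U V = (\<lambda>_. - c) * killing_form g k U V)"


section \<open>The matrix of \<open>J\<close>\<close>

definition J_matrix :: "real \<Rightarrow> real \<Rightarrow> real \<Rightarrow> real \<Rightarrow> real \<Rightarrow> real \<Rightarrow> real list list" where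
  "J_matrix l1 m1 n1 l2 m2 n2 =
    [[0,         n1,        m1,        l1 * l2,   - l1 * m2, l1 * n2,   0, 0],
     [- n1,      0,         l1,        - m1 * l2, m1 * m2,   - m1 * n2, 0, 0],
     [- m1,      - l1,      0,         n1 * l2,   - n1 * m2, n1 * n2,   0, 0],
     [- l1 * l2, m1 * l2,   - n1 * l2, 0,         n2,        m2,        0, 0],
     [l1 * m2,   - m1 * m2, n1 * m2,   - n2,      0,         l2,        0, 0],
     [- l1 * n2, m1 * n2,   - n1 * n2, - m2,      - l2,      0,         0, 0],
     [0,         0,         0,         0,         0,         0,         0, - 1],
     [0,         0,         0,         0,         0,         0,         1, 0]]"

text \<open>Columns hold the coordinates of the images of the basis vectors.\<close>

definition has_matrix :: "('m vf \<Rightarrow> 'm vf) \<Rightarrow> 'm vf list \<Rightarrow> real list list \<Rightarrow> bool" where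
  "has_matrix J e M \<longleftrightarrow>
     (\<forall>j<length e. J (e ! j) = lin_comb (map (\<lambda>i. M ! i ! j) [0..<length e]) e)"

end

theory Submission
  imports Defs
begin

text \<open>Cyclic summation of the \<open>W\<^sub>4\<close> condition gives \<open>d\<omega> = \<theta> \<and> \<omega>\<close> for some 1-form \<open>\<theta>\<close>; only
  vanishing of the torsion of \<open>\<nabla>\<close> is used. The Kaehler condition is the case \<open>\<theta> = 0\<close>. On
  \<open>su(2) \<oplus> su(2)\<close>, with bases \<open>a\<^sub>i\<close> and \<open>f\<^sub>j\<close> of the summands, there are unit vectors \<open>u, v\<close> with
  \<open>\<omega>(a\<^sub>i, f\<^sub>j) = u\<^sub>i v\<^sub>j\<close>, while \<open>\<omega>(a\<^sub>i, a\<^sub>j) = - u\<^sub>k\<close> and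
  \<open>\<omega>(f\<^sub>i, f\<^sub>j) = v\<^sub>k\<close> for cyclic \<open>(i, j, k)\<close>. Evaluating \<open>d\<omega> = \<theta> \<and> \<omega>\<close> on \<open>(a\<^sub>m, f\<^sub>i, f\<^sub>j)\<close> and contracting with \<open>v\<close> yields
  \<open>\<theta>(a\<^sub>m) = 2 u\<^sub>m\<close>. On \<open>(a\<^sub>1, a\<^sub>2, a\<^sub>3)\<close> the left-hand side vanishes and the right-hand side
  is \<open>- 2 |u|\<^sup>2 = - 2\<close>, a contradiction.\<close>

section \<open>Smooth functions and vector fields\<close>

text \<open>Derivatives at a point depend only on values nearby, and an open \<open>S\<close>
  contains a neighbourhood of each of its points. The inductions below rely on this: their
  derivative rules are equations valid only on \<open>S\<close>.\<close>

lemma Ck_on_cong: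
  assumes "open S" and "Ck_on k S f" and "\<And>x. x \<in> S \<Longrightarrow> f x = h x"
  shows "Ck_on k S h"
  using assms(2,3)
proof (induction k arbitrary: f h)
  case 0
  then show ?case by (simp cong: continuous_on_cong)
next
  case (Suc k)
  have deriv: "(h has_derivative frechet_derivative f (at x)) (at x)" if "x \<in> S" for x
  proof (rule has_derivative_transform_within_open[OF _ \<open>open S\<close> that])
    show "(f has_derivative frechet_derivative f (at x)) (at x)"
      using Suc.prems(1) that by (simp flip: frechet_derivative_works)
  qed (rule Suc.prems(2))
  have eq: "frechet_derivative h (at x) = frechet_derivative f (at x)" if "x \<in> S" for x
    by (rule frechet_derivative_at[OF deriv[OF that], symmetric])
  have "Ck_on k S (\<lambda>x. frechet_derivative h (at x) v)" for v
    by (rule Suc.IH[of "\<lambda>x. frechet_derivative f (at x) v"]) (use Suc.prems(1) eq in simp_all)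
  then show ?case using deriv by (auto simp: differentiable_def)
qed

lemma Ck_on_const: "Ck_on k S (\<lambda>_. c)"
  by (induction k arbitrary: c) (auto simp: frechet_derivative_const)

lemma Ck_on_add:
  assumes "open S" and "Ck_on k S f" and "Ck_on k S h"
  shows "Ck_on k S (\<lambda>x. f x + h x)"
  using assms(2,3)
proof (induction k arbitrary: f h)
  case 0
  then show ?case by (simp add: continuous_on_add)
next
  case (Suc k)
  have eq: "frechet_derivative (\<lambda>x. f x + h x) (at x) v =
      frechet_derivative f (at x) v + frechet_derivative h (at x) v" if "x \<in> S" for x v
    using Suc.prems that
    by (subst frechet_derivative_at[OF has_derivative_add, symmetric])
      (auto simp flip: frechet_derivative_works)
  have "Ck_on k S (\<lambda>x. frechet_derivative (\<lambda>x. f x + h x) (at x) v)" for v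
    by (rule Ck_on_cong[OF \<open>open S\<close> Suc.IH[of "\<lambda>x. frechet_derivative f (at x) v"
          "\<lambda>x. frechet_derivative h (at x) v"]]) (use Suc.prems eq in auto)
  then show ?case using Suc.prems by auto
qed

text \<open>Composition with a fixed linear map commutes with differentiation, so the induction
  needs no product rule; scaling by a constant is the case used.\<close>

lemma Ck_on_bounded_linear:
  assumes "open S" and "bounded_linear l" and "Ck_on k S f"
  shows "Ck_on k S (\<lambda>x. l (f x))"
  using assms(3)
proof (induction k arbitrary: f)
  case 0
  then show ?case using bounded_linear.continuous_on[OF assms(2)] by simp
next
  case (Suc k)
  have deriv: "((\<lambda>x. l (f x)) has_derivative (\<lambda>v. l (frechet_derivative f (at x) v))) (at x)"
    if "x \<in> S" for x
    using Suc.prems that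
    by (intro bounded_linear.has_derivative[OF assms(2)]) (simp flip: frechet_derivative_works)
  have eq: "frechet_derivative (\<lambda>x. l (f x)) (at x) = (\<lambda>v. l (frechet_derivative f (at x) v))"
    if "x \<in> S" for x
    by (rule frechet_derivative_at[OF deriv[OF that], symmetric])
  have "Ck_on k S (\<lambda>x. frechet_derivative (\<lambda>x. l (f x)) (at x) v)" for v
    by (rule Ck_on_cong[OF \<open>open S\<close> Suc.IH[of "\<lambda>x. frechet_derivative f (at x) v"]])
      (use Suc.prems eq in auto)
  then show ?case using deriv by (auto simp: differentiable_def)
qed

section \<open>Smooth functions on the manifold and their derivations\<close>

lemma C_infty_add:
  assumes "f \<in> C_infty \<A>" and "h \<in> C_infty \<A>"
  shows "f + h \<in> C_infty \<A>"
  using assms unfolding C_infty_def smooth_on_def o_def by (fastforce intro: Ck_on_add)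

lemma C_infty_const_mult:
  assumes "f \<in> C_infty \<A>"
  shows "(\<lambda>_. c) * f \<in> C_infty \<A>"
  using assms unfolding C_infty_def smooth_on_def o_def
  by (fastforce intro: Ck_on_bounded_linear[OF _ bounded_linear_mult_right])

lemma C_infty_const:
  assumes "smooth_atlas \<A>"
  shows "(\<lambda>_. c) \<in> C_infty \<A>"
  using assms unfolding smooth_atlas_def C_infty_def smooth_on_def o_def
  by (fastforce intro: Ck_on_const)

text \<open>The Leibniz rule for 1 * 1 = 1 gives D 1 = 2 D 1, hence D 1 = 0; linearity then covers
  every constant.\<close>

lemma vector_field_const:
  assumes "smooth_atlas \<A>" and "D \<in> vector_fields \<A>"
  shows "D (\<lambda>_. c) = 0"
proof -
  have one: "(\<lambda>_. 1) \<in> C_infty \<A>" by (rule C_infty_const[OF assms(1)])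
  have "D ((\<lambda>_. 1) * (\<lambda>_. 1)) = D (\<lambda>_. 1) * (\<lambda>_. 1) + (\<lambda>_. 1) * D (\<lambda>_. 1)"
    using assms(2) one unfolding vector_fields_def by blast
  then have "D (\<lambda>_. 1) = 0" by (simp add: fun_eq_iff times_fun_def)
  moreover have "D ((\<lambda>_. c) * (\<lambda>_. 1)) = (\<lambda>_. c) * D (\<lambda>_. 1)"
    using assms(2) one unfolding vector_fields_def by blast
  ultimately show ?thesis by (simp add: times_fun_def zero_fun_def)
qed

lemma vector_fields_add:
  assumes "D \<in> vector_fields \<A>" and "E \<in> vector_fields \<A>"
  shows "D + E \<in> vector_fields \<A>"
  using assms unfolding vector_fields_def
  by (auto simp: C_infty_add algebra_simps)

lemma vector_fields_cmul:
  assumes "D \<in> vector_fields \<A>"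
  shows "c \<cdot> D \<in> vector_fields \<A>"
  using assms unfolding vector_fields_def smul_def
  by (auto simp: C_infty_const_mult algebra_simps)

text \<open>The linearity axioms for \<open>g\<close> and \<open>J\<close> speak of sums and
  function multiples only. Writing negatives and zero as constant multiples brings them under these
  axioms.\<close>

lemma uminus_eq_cmul: "- D = (-1) \<cdot> (D :: 'm vf)"
  by (simp add: fun_eq_iff smul_def)

lemma zero_eq_cmul: "0 = 0 \<cdot> (D :: 'm vf)"
  by (simp add: fun_eq_iff smul_def)

lemma vector_fields_uminus:
  assumes "D \<in> vector_fields \<A>"
  shows "- D \<in> vector_fields \<A>"
  using vector_fields_cmul[OF assms] by (simp add: uminus_eq_cmul)

lemma lie_bracket_commute: "lie_bracket E D = - lie_bracket D E"
  by (simp add: lie_bracket_def fun_eq_iff)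


section \<open>The fundamental form\<close>

locale almost_hermitian_manifold =
  fixes \<A> :: "('m::{t2_space,second_countable_topology}, 'e::euclidean_space) atlas"
    and g :: "'m metric" and J :: "'m vf \<Rightarrow> 'm vf"
  assumes atlas: "smooth_atlas \<A>"
    and metric: "riemannian_metric \<A> g"
    and hermitian: "almost_hermitian \<A> g J"
begin

abbreviation "\<omega> \<equiv> kaehler_form g J"

lemma metric_commute: "D \<in> vector_fields \<A> \<Longrightarrow> E \<in> vector_fields \<A> \<Longrightarrow> g D E = g E D"
  using metric unfolding riemannian_metric_def by blast

lemma metric_add_left:
  assumes "D \<in> vector_fields \<A>" "E \<in> vector_fields \<A>" "F \<in> vector_fields \<A>"
  shows "g (D + E) F = g D F + g E F"
  using assms metric unfolding riemannian_metric_def by blast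

lemma metric_cmul_left:
  assumes "D \<in> vector_fields \<A>" "E \<in> vector_fields \<A>"
  shows "g (c \<cdot> D) E = (\<lambda>_. c) * g D E"
  using assms metric C_infty_const[OF atlas] unfolding riemannian_metric_def by blast

lemma metric_sum_left:
  fixes n :: nat
  assumes "\<And>i. i < n \<Longrightarrow> e i \<in> vector_fields \<A>" and "D \<in> vector_fields \<A>"
  shows "g (\<Sum>i<n. c i \<cdot> e i) D p = (\<Sum>i<n. c i * g (e i) D p)"
proof -
  have zero: "0 \<in> vector_fields \<A>"
    using vector_fields_cmul[OF assms(2), of 0] by (simp add: zero_eq_cmul[symmetric])
  \<comment> \<open>Additivity of \<open>g\<close> is available only on
    \<open>vector_fields \<A>\<close>, so the induction must also carry membership of the partial
    sums.\<close>
  have "(\<Sum>i<n. c i \<cdot> e i) \<in> vector_fields \<A> \<and>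
      g (\<Sum>i<n. c i \<cdot> e i) D p = (\<Sum>i<n. c i * g (e i) D p)"
    using assms(1)
  proof (induction n)
    case 0
    then show ?case
      using zero metric_cmul_left[OF assms(2,2), of 0]
      by (simp add: zero_eq_cmul[symmetric] del: zero_fun_apply)
  next
    case (Suc n)
    then show ?case
      by (simp add: assms(2) vector_fields_add vector_fields_cmul metric_add_left metric_cmul_left
          sum.lessThan_Suc[of "\<lambda>i. c i \<cdot> e i"] del: plus_fun_apply sum.lessThan_Suc) simp
  qed
  then show ?thesis by blast
qed

lemma J_closed: "D \<in> vector_fields \<A> \<Longrightarrow> J D \<in> vector_fields \<A>"
  using hermitian unfolding almost_hermitian_def by blast

lemma J_cmul: "D \<in> vector_fields \<A> \<Longrightarrow> J (c \<cdot> D) = c \<cdot> J D"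
  using hermitian C_infty_const[OF atlas] unfolding almost_hermitian_def by blast

lemma kaehler_form_add_left:
  assumes "D \<in> vector_fields \<A>" "E \<in> vector_fields \<A>" "F \<in> vector_fields \<A>"
  shows "\<omega> (D + E) F = \<omega> D F + \<omega> E F"
  using assms hermitian unfolding kaehler_form_def almost_hermitian_def
  by (simp add: metric_add_left)

lemma kaehler_form_cmul_left:
  assumes "D \<in> vector_fields \<A>" "E \<in> vector_fields \<A>"
  shows "\<omega> (c \<cdot> D) E = (\<lambda>_. c) * \<omega> D E"
  using assms unfolding kaehler_form_def by (simp add: J_cmul J_closed metric_cmul_left)

lemma kaehler_form_uminus_left:
  assumes "D \<in> vector_fields \<A>" "E \<in> vector_fields \<A>"
  shows "\<omega> (- D) E = - \<omega> D E"
  using kaehler_form_cmul_left[OF assms, of "-1"] by (simp add: uminus_eq_cmul fun_eq_iff)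

lemma kaehler_form_zero_left:
  assumes "E \<in> vector_fields \<A>"
  shows "\<omega> 0 E = 0"
  using kaehler_form_cmul_left[OF assms assms, of 0]
  by (simp add: zero_eq_cmul[symmetric] fun_eq_iff)

text \<open>\<open>J\<close> is an isometry with square -1, so g(JE, D) = g(JJE, JD) = - g(E, JD),
  and symmetry of \<open>g\<close> finishes.\<close>

lemma kaehler_form_commute:
  assumes "D \<in> vector_fields \<A>" "E \<in> vector_fields \<A>"
  shows "\<omega> E D = - \<omega> D E"
proof -
  have "\<omega> E D = g (J (J E)) (J D)"
    using assms hermitian unfolding kaehler_form_def almost_hermitian_def by metis
  also have "J (J E) = (-1) \<cdot> E"
    using assms hermitian unfolding almost_hermitian_def by (simp add: uminus_eq_cmul)
  also have "g \<dots> (J D) = - g (J D) E"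
    using assms metric_commute[of E "J D"]
    by (intro ext) (simp add: metric_cmul_left J_closed)
  finally show ?thesis unfolding kaehler_form_def .
qed

text \<open>The indices are swapped because column i of \<open>M\<close> holds the coordinates of
  J(e_i), and pairing with e_j picks out its row j.\<close>

lemma kaehler_form_frame:
  assumes "set e \<subseteq> vector_fields \<A>" and "orthonormal g e" and "has_matrix J e M"
    and "i < length e" and "j < length e"
  shows "\<omega> (e ! i) (e ! j) = (\<lambda>_. M ! j ! i)"
proof
  fix p
  have "\<omega> (e ! i) (e ! j) p = (\<Sum>k<length e. M ! k ! i * g (e ! k) (e ! j) p)"
    using assms unfolding kaehler_form_def has_matrix_def lin_comb_def
    by (subst assms(3)[unfolded has_matrix_def lin_comb_def, rule_format, OF assms(4)],
        subst metric_sum_left) (auto intro!: sum.cong)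
  also have "\<dots> = (\<Sum>k<length e. if k = j then M ! k ! i else 0)"
    using assms by (intro sum.cong) (auto simp: orthonormal_def)
  finally show "\<omega> (e ! i) (e ! j) p = M ! j ! i" using assms by simp
qed

text \<open>Vanishing torsion turns each bracket into a difference of covariant derivatives; the six
  resulting terms regroup into the cyclic sum by skew-symmetry of \<omega>.\<close>

lemma ext_deriv2_kaehler_form:
  assumes "levi_civita \<A> g nab"
    and fields: "E \<in> vector_fields \<A>" "F \<in> vector_fields \<A>" "Z \<in> vector_fields \<A>"
  shows "ext_deriv2 \<omega> E F Z = nabla_omega g J nab E F Z + nabla_omega g J nab F Z E
    + nabla_omega g J nab Z E F"
proof -
  have nab: "nab U V \<in> vector_fields \<A>" if "U \<in> vector_fields \<A>" "V \<in> vector_fields \<A>" for U V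
    using that assms(1) unfolding levi_civita_def by blast
  have bracket: "\<omega> (lie_bracket U V) W = \<omega> (nab U V) W - \<omega> (nab V U) W"
    if "U \<in> vector_fields \<A>" "V \<in> vector_fields \<A>" "W \<in> vector_fields \<A>" for U V W
  proof -
    have "lie_bracket U V = nab U V + - nab V U"
      using that assms(1) unfolding levi_civita_def by (metis diff_conv_add_uminus)
    then show ?thesis
      using that
      by (simp add: nab kaehler_form_add_left kaehler_form_uminus_left vector_fields_uminus
          del: add_uminus_conv_diff)
  qed
  \<comment> \<open>\<open>ext_deriv2\<close> differentiates \<omega>(E, Z) along F, the cyclic sum
    \<omega>(Z, E). The sign passes through F only after \<omega>(Z, E) is known to be
    smooth.\<close>
  have "\<omega> E Z = (\<lambda>_. -1) * \<omega> Z E"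
    using kaehler_form_commute[OF fields(3,1)] by (simp add: fun_eq_iff)
  moreover have "\<omega> Z E \<in> C_infty \<A>"
    using metric fields J_closed unfolding riemannian_metric_def kaehler_form_def by blast
  moreover have "F ((\<lambda>_. c) * f) = (\<lambda>_. c) * F f" if "f \<in> C_infty \<A>" for c f
    using fields(2) that unfolding vector_fields_def by blast
  ultimately have "F (\<omega> E Z) = - F (\<omega> Z E)"
    by (simp only:) (simp add: fun_eq_iff)
  then show ?thesis
    using fields
    by (simp add: ext_deriv2_def nabla_omega_def bracket nab kaehler_form_commute[of "nab _ _"])
qed

text \<open>In the cyclic sum the terms with g(E, F) cancel by symmetry, while each product of
  \<omega>(E, F) with the trace at JZ occurs twice. This gives the 1-form
  \<open>- 2 * ?c * ?\<tau> (J Z) p\<close>.\<close>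

lemma class_W4_imp_ext_deriv2:
  assumes "class_W4 \<A> g J nab" and "levi_civita \<A> g nab" and "orthonormal_frame_at \<A> g p e"
  shows "\<exists>\<theta>. \<forall>E\<in>vector_fields \<A>. \<forall>F\<in>vector_fields \<A>. \<forall>Z\<in>vector_fields \<A>.
    ext_deriv2 \<omega> E F Z p = \<omega> E F p * \<theta> Z + \<omega> F Z p * \<theta> E + \<omega> Z E p * \<theta> F"
proof (intro exI ballI)
  let ?c = "1 / (2 * (real DIM('e) / 2 - 1))" and ?\<tau> = "nabla_omega_trace g J nab e"
  fix E F Z
  assume fields: "E \<in> vector_fields \<A>" "F \<in> vector_fields \<A>" "Z \<in> vector_fields \<A>"
  have \<omega>: "g U (J V) p = - \<omega> U V p" "\<omega> V U p = - \<omega> U V p" "g U V = g V U"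
    if "U \<in> vector_fields \<A>" "V \<in> vector_fields \<A>" for U V
    using kaehler_form_commute[OF that] metric_commute[of U "J V"] metric_commute[of U V] that J_closed
    by (auto simp: kaehler_form_def)
  have W4: "nabla_omega g J nab U V W p = - ?c * (g U V p * ?\<tau> W p - g U W p * ?\<tau> V p
      - g U (J V) p * ?\<tau> (J W) p + g U (J W) p * ?\<tau> (J V) p)"
    if "U \<in> vector_fields \<A>" "V \<in> vector_fields \<A>" "W \<in> vector_fields \<A>" for U V W
    using that assms(1,3) unfolding class_W4_def Let_def by blast
  show "ext_deriv2 \<omega> E F Z p = \<omega> E F p * (- 2 * ?c * ?\<tau> (J Z) p)
      + \<omega> F Z p * (- 2 * ?c * ?\<tau> (J E) p) + \<omega> Z E p * (- 2 * ?c * ?\<tau> (J F) p)"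
    unfolding ext_deriv2_kaehler_form[OF assms(2) fields] plus_fun_apply
    using fields \<omega>(2)[of E F] \<omega>(2)[of F Z] \<omega>(2)[of Z E]
      \<omega>(3)[of E F] \<omega>(3)[of F Z] \<omega>(3)[of Z E]
    unfolding W4[OF fields] W4[OF fields(2,3,1)] W4[OF fields(3,1,2)]
    by (simp add: \<omega>(1) algebra_simps)
qed

end

section \<open>The contradiction on su(2) + su(2)\<close>

theorem mainTheorem3:
  fixes \<A> :: "('g::{t2_space,second_countable_topology}, real^8) atlas"
    and gmul :: "'g \<Rightarrow> 'g \<Rightarrow> 'g" and gid :: 'g and ginv :: "'g \<Rightarrow> 'g"
    and \<iota> :: "(complex^2^2) \<times> (complex^2^2) \<Rightarrow> 'g"
    and g :: "'g metric" and nab :: "'g vf \<Rightarrow> 'g vf \<Rightarrow> 'g vf" and J :: "'g vf \<Rightarrow> 'g vf"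
    and A B C R S T X Y :: "'g vf"
    and \<rho> b11 b21 c11 c12 c21 c22 s14 s24 t14 t15 t24 t25 :: real
    and \<theta>1 \<theta>2 \<theta>3 \<theta>4 \<theta>5 \<theta>6 :: real
    and l1 m1 n1 l2 m2 n2 :: real
  assumes "lie_group \<A> gmul gid ginv"
    and "SU2xSU2_subgroup \<A> gmul gid \<iota> [A, B, C, R, S, T]"
    and "riemannian_metric \<A> g" and "left_invariant_metric \<A> gmul g"
    and "lie_algebra_basis \<A> gmul [A, B, C, R, S, T, X, Y]"
    and "orthonormal g [A, B, C, R, S, T, X, Y]"
    and "killing_metric g [A, B, C, R, S, T]"
    and "levi_civita \<A> g nab"
    and "lie_bracket A B = 2 \<cdot> C" and "lie_bracket B C = 2 \<cdot> A" and "lie_bracket C A = 2 \<cdot> B"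
    and "lie_bracket R S = 2 \<cdot> T" and "lie_bracket S T = 2 \<cdot> R" and "lie_bracket T R = 2 \<cdot> S"
    and "\<forall>U\<in>{A, B, C}. \<forall>V\<in>{R, S, T}. lie_bracket U V = 0"
    and "lie_bracket A X = - b11 \<cdot> B - c11 \<cdot> C" and "lie_bracket A Y = - b21 \<cdot> B - c21 \<cdot> C"
    and "lie_bracket B X = b11 \<cdot> A - c12 \<cdot> C" and "lie_bracket B Y = b21 \<cdot> A - c22 \<cdot> C"
    and "lie_bracket C X = c11 \<cdot> A + c12 \<cdot> B" and "lie_bracket C Y = c21 \<cdot> A + c22 \<cdot> B"
    and "lie_bracket R X = - s14 \<cdot> S - t14 \<cdot> T" and "lie_bracket R Y = - s24 \<cdot> S - t24 \<cdot> T"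
    and "lie_bracket S X = s14 \<cdot> R - t15 \<cdot> T" and "lie_bracket S Y = s24 \<cdot> R - t25 \<cdot> T"
    and "lie_bracket T X = t14 \<cdot> R + t15 \<cdot> S" and "lie_bracket T Y = t24 \<cdot> R + t25 \<cdot> S"
    and "lie_bracket X Y = \<rho> \<cdot> X + \<theta>1 \<cdot> A + \<theta>2 \<cdot> B + \<theta>3 \<cdot> C + \<theta>4 \<cdot> R + \<theta>5 \<cdot> S + \<theta>6 \<cdot> T"
    and "2 * \<theta>1 = - \<rho> * c12 + b11 * c21 - b21 * c11"
    and "2 * \<theta>2 = \<rho> * c11 + b11 * c22 - b21 * c12"
    and "2 * \<theta>3 = - \<rho> * b11 + c11 * c22 - c12 * c21"
    and "2 * \<theta>4 = - \<rho> * t15 + s14 * t24 - s24 * t14"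
    and "2 * \<theta>5 = \<rho> * t14 + s14 * t25 - s24 * t15"
    and "2 * \<theta>6 = - \<rho> * s14 + t14 * t25 - t15 * t24"
    and "l1\<^sup>2 + m1\<^sup>2 + n1\<^sup>2 = 1" and "l2\<^sup>2 + m2\<^sup>2 + n2\<^sup>2 = 1"
    and "almost_hermitian \<A> g J" and "left_invariant_endo \<A> gmul J"
    and "has_matrix J [A, B, C, R, S, T, X, Y] (J_matrix l1 m1 n1 l2 m2 n2)"
  shows "\<not> class_W4 \<A> g J nab \<and> \<not> kaehler \<A> g J"
proof -
  let ?e = "[A, B, C, R, S, T, X, Y]"
  let ?\<omega> = "kaehler_form g J"
  interpret almost_hermitian_manifold \<A> g J
    using assms unfolding lie_group_def by unfold_locales auto
  have fields: "set ?e \<subseteq> vector_fields \<A>"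
    using assms(5) unfolding lie_algebra_basis_def left_invariant_fields_def by blast
  then have vf: "A \<in> vector_fields \<A>" "B \<in> vector_fields \<A>" "C \<in> vector_fields \<A>"
    "R \<in> vector_fields \<A>" "S \<in> vector_fields \<A>" "T \<in> vector_fields \<A>" by auto
  note form = kaehler_form_frame[OF fields assms(6) assms(39)]
  \<comment> \<open>With a = (A, B, C) and f = (R, S, T), the vectors of the outline are u = (l1,
    -m1, n1) and v = (-l2, m2, -n2).\<close>
  have ee: "?\<omega> A B = (\<lambda>_. - n1)" "?\<omega> B C = (\<lambda>_. - l1)" "?\<omega> C A = (\<lambda>_. m1)"
    using form[of 0 1] form[of 1 2] form[of 2 0] by (auto simp: J_matrix_def)
  have ff: "?\<omega> R S = (\<lambda>_. - n2)" "?\<omega> S T = (\<lambda>_. - l2)" "?\<omega> T R = (\<lambda>_. m2)"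
    using form[of 3 4] form[of 4 5] form[of 5 3] by (auto simp: J_matrix_def)
  have ef: "?\<omega> A R = (\<lambda>_. - l1 * l2)" "?\<omega> A S = (\<lambda>_. l1 * m2)" "?\<omega> A T = (\<lambda>_. - l1 * n2)"
    "?\<omega> B R = (\<lambda>_. m1 * l2)" "?\<omega> B S = (\<lambda>_. - m1 * m2)" "?\<omega> B T = (\<lambda>_. m1 * n2)"
    "?\<omega> C R = (\<lambda>_. - n1 * l2)" "?\<omega> C S = (\<lambda>_. n1 * m2)" "?\<omega> C T = (\<lambda>_. - n1 * n2)"
    using form[of 0 3] form[of 0 4] form[of 0 5] form[of 1 3] form[of 1 4] form[of 1 5]
      form[of 2 3] form[of 2 4] form[of 2 5] by (auto simp: J_matrix_def)
  have fe: "?\<omega> V U = - ?\<omega> U V" if "U \<in> {A, B, C}" "V \<in> {R, S, T}" for U V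
    using kaehler_form_commute[of U V] that vf by blast
  have self: "?\<omega> U U p = 0" if "U \<in> vector_fields \<A>" for U p
    using kaehler_form_commute[OF that that] by (simp add: fun_eq_iff)
  have mixed: "lie_bracket U V = 0" if "U \<in> {A, B, C}" "V \<in> {R, S, T}" for U V
    using assms(15) that by blast
  have const: "D (\<lambda>_. c) p = 0" if "D \<in> vector_fields \<A>" for D c p
    using vector_field_const[OF atlas that] by simp
  \<comment> \<open>Each bracket of two of A, B, C is a multiple of the third, so every bracket term
    of d\<omega>(A, B, C) has the form \<omega>(U, U) up to a factor.\<close>
  have "?\<omega> (lie_bracket A C) B p = 0" for p
    using vf self by (simp add: lie_bracket_commute[of A C] assms(11) kaehler_form_cmul_left
        kaehler_form_uminus_left vector_fields_cmul)
  moreover have "?\<omega> A C = (\<lambda>_. - m1)"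
    using form[of 0 2] by (simp add: J_matrix_def)
  ultimately have closed_ABC: "ext_deriv2 ?\<omega> A B C p = 0" for p
    using vf self by (simp add: ext_deriv2_def ee const assms(9,10) kaehler_form_cmul_left)
  \<comment> \<open>One pointwise statement with arbitrary \<theta> serves both claims: \<theta>
    comes from the trace for \<open>class_W4\<close> and is 0 for \<open>kaehler\<close>.\<close>
  have no_conformal: False
    if eq: "\<And>E F Z. E \<in> vector_fields \<A> \<Longrightarrow> F \<in> vector_fields \<A> \<Longrightarrow> Z \<in> vector_fields \<A> \<Longrightarrow>
      ext_deriv2 ?\<omega> E F Z p = ?\<omega> E F p * \<theta> Z + ?\<omega> F Z p * \<theta> E + ?\<omega> Z E p * \<theta> F" for \<theta> p
  proof -
    \<comment> \<open>On (U, V, W) the constant values of \<omega> kill the derivative terms and U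
      commutes with V and W. Only -\<omega>([V, W], U) = 2 \<omega>(U, W') survives.\<close>
    have bracket: "2 * ?\<omega> U W' p = ?\<omega> U V p * \<theta> W + ?\<omega> V W p * \<theta> U - ?\<omega> U W p * \<theta> V"
      if "U \<in> {A, B, C}" "V \<in> {R, S, T}" "W \<in> {R, S, T}" "W' \<in> {R, S, T}"
        and VW: "lie_bracket V W = 2 \<cdot> W'"
        and cs: "?\<omega> U V = (\<lambda>_. c)" "?\<omega> U W = (\<lambda>_. c')" "?\<omega> V W = (\<lambda>_. c'')" for U V W W' c c' c''
    proof -
      have UVW: "U \<in> vector_fields \<A>" "V \<in> vector_fields \<A>" "W \<in> vector_fields \<A>"
        "W' \<in> vector_fields \<A>"
        using that(1-4) vf by blast+
      then have "ext_deriv2 ?\<omega> U V W p = - ?\<omega> (2 \<cdot> W') U p"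
        using that(1-3) unfolding ext_deriv2_def VW cs
        by (simp add: mixed const kaehler_form_zero_left)
      also have "\<dots> = 2 * ?\<omega> U W' p"
        using UVW fe[OF that(1,4)] by (simp add: kaehler_form_cmul_left)
      finally show ?thesis using eq[OF UVW(1-3)] fe[OF that(1,3)] by simp
    qed
    have \<theta>: "\<theta> U = 2 * u"
      if U: "U \<in> {A, B, C}"
        and "?\<omega> U R = (\<lambda>_. - u * l2)" "?\<omega> U S = (\<lambda>_. u * m2)" "?\<omega> U T = (\<lambda>_. - u * n2)" for U u
    proof -
      have "2 * (- u * n2) = - u * l2 * \<theta> S + - n2 * \<theta> U - u * m2 * \<theta> R"
        using bracket[OF U, of R S T] that ff assms(12) by simp
      moreover have "2 * (- u * l2) = u * m2 * \<theta> T + - l2 * \<theta> U - (- u * n2) * \<theta> S"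
        using bracket[OF U, of S T R] that ff assms(13) by simp
      moreover have "2 * (u * m2) = - u * n2 * \<theta> R + m2 * \<theta> U - (- u * l2) * \<theta> T"
        using bracket[OF U, of T R S] that ff assms(14) by simp
      \<comment> \<open>Multiply each equation by the component of v attached to its bracket and
        add. The values of \<theta> on R, S, T enter through the triple product v . (v x \<theta>) =
        0, and |v| = 1 leaves 2 u = \<theta>(U).\<close>
      ultimately show ?thesis using assms(36) by algebra
    qed
    have "\<theta> A = 2 * l1" "\<theta> B = 2 * - m1" "\<theta> C = 2 * n1"
      by (rule \<theta>; simp add: ef)+
    then have "- 2 * (l1\<^sup>2 + m1\<^sup>2 + n1\<^sup>2) = 0"
      using eq[of A B C] vf closed_ABC ee by (simp add: power2_eq_square algebra_simps)
    then show False using assms(35) by simp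
  qed
  show ?thesis
  proof
    show "\<not> class_W4 \<A> g J nab"
    proof
      assume "class_W4 \<A> g J nab"
      \<comment> \<open>The basis is orthonormal at every point and has 8 = DIM(real^8) members, so
        it is a frame at \<open>gid\<close>.\<close>
      moreover have "orthonormal_frame_at \<A> g gid ?e"
        using fields assms(6) unfolding orthonormal_frame_at_def orthonormal_def by simp
      ultimately show False
        using class_W4_imp_ext_deriv2[OF _ assms(8)] no_conformal by blast
    qed
    show "\<not> kaehler \<A> g J"
    proof
      assume "kaehler \<A> g J"
      then show False
        using no_conformal[of gid "\<lambda>_. 0"] unfolding kaehler_def by simp
    qed
  qed
qed

end
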